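(* Let $N$ be an odd prime and let $\alpha\in R=\mathbb{R}[x]/\langle x^N-1\rangle$ be the autocorrelation of a binary element, i.e. $\alpha=\beta\overline{\beta}$ for some binary $\beta\in R$. Define the subsets of $R$ $$B=\{\beta\in R:\ [\beta]_i=\pm\tfrac12,\ 0\le i\le N-1\},\qquad h(B)=\{\beta\in R:\ |[\beta]_i|\le\tfrac12,\ 0\le i\le N-1\},$$ $$T_\alpha=\{\tau\in R:\ \tau\overline{\tau}=\alpha\},\qquad h(T_\alpha)=\{\tau\in R:\ |\sigma_i(\tau)|\le\sqrt{\sigma_i(\alpha)},\ 0\le i\le (N-1)/2\}.$$ Then $$B\cap T_\alpha=h(B)\cap T_\alpha=B\cap h(T_\alpha).$$
   Context: $R=\mathbb{R}[x]/\langle x^N-1\rangle$ (cyclic convolution ring); an element $\alpha\in R$ is written $\alpha=\sum_{i=0}^{N-1}[\alpha]_i x^i$. An element $\beta\in R$ is called binary if $[\beta]_i=\pm\frac12$ for all $0\le i\le N-1$ and $\beta$ is not a multiple of $\Phi_N=1+x+\dots+x^{N-1}$ (i.e. not all components are equal). Conjugation on $R$: $[\overline{\alpha}]_0=[\alpha]_0$ and $[\overline{\alpha}]_j=[\alpha]_{N-j}$ for $1\le j\le N-1$. With $\zeta=e^{2\pi i/N}$, the Fourier components are $\sigma_j(\alpha)=\sum_{k=0}^{N-1}[\alpha]_k\zeta^{jk}$ for $0\le j\le N-1$; for $\alpha=\beta\overline\beta$ one has $\sigma_j(\alpha)=|\sigma_j(\beta)|^2\ge 0$, so the square roots are real. (The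 set $h(T_\alpha)$ is the convex hull of $T_\alpha$ and $h(B)$ that of $B$.) *)

theory Defs
  imports "HOL-Analysis.Analysis" "HOL-Computational_Algebra.Computational_Algebra"
begin

text \<open>
  A residue class in \<open>\<real>[x]/\<langle>x^N - 1\<rangle>\<close> is represented by its unique representative of degree
  less than \<open>N\<close> (for \<open>N \<ge> 1\<close>), so that \<open>[\<alpha>]\<^sub>i\<close> is \<open>coeff \<alpha> i\<close>. Addition and scalar
  multiplication are those of polynomials; the product is reduced modulo \<open>x^N - 1\<close>.
\<close>

definition cyc_ring :: "nat \<Rightarrow> real poly set" where
  "cyc_ring N = {\<alpha>. degree \<alpha> < N}"

definition cyc_mult :: "nat \<Rightarrow> real poly \<Rightarrow> real poly \<Rightarrow> real poly" where
  "cyc_mult N \<alpha> \<beta> = (\<alpha> * \<beta>) mod (monom 1 N - 1)"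

definition cyc_conj :: "nat \<Rightarrow> real poly \<Rightarrow> real poly" where
  "cyc_conj N \<alpha> = (\<Sum>j<N. monom (if j = 0 then coeff \<alpha> 0 else coeff \<alpha> (N - j)) j)"

definition cyc_Phi :: "nat \<Rightarrow> real poly" where
  "cyc_Phi N = (\<Sum>i<N. monom 1 i)"

definition fourier :: "nat \<Rightarrow> nat \<Rightarrow> real poly \<Rightarrow> complex" where
  "fourier N j \<alpha> = (\<Sum>k<N. of_real (coeff \<alpha> k) * exp (2 * of_real pi * \<i> / of_nat N) ^ (j * k))"

definition cyc_B :: "nat \<Rightarrow> real poly set" where
  "cyc_B N = {\<beta> \<in> cyc_ring N. \<forall>i<N. coeff \<beta> i = 1/2 \<or> coeff \<beta> i = - 1/2}"

definition cyc_hB :: "nat \<Rightarrow> real poly set" where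
  "cyc_hB N = {\<beta> \<in> cyc_ring N. \<forall>i<N. \<bar>coeff \<beta> i\<bar> \<le> 1/2}"

definition cyc_binary :: "nat \<Rightarrow> real poly \<Rightarrow> bool" where
  "cyc_binary N \<beta> \<longleftrightarrow> \<beta> \<in> cyc_B N \<and> \<not> (\<exists>\<gamma> \<in> cyc_ring N. \<beta> = cyc_mult N \<gamma> (cyc_Phi N))"

definition cyc_T :: "nat \<Rightarrow> real poly \<Rightarrow> real poly set" where
  "cyc_T N \<alpha> = {\<tau> \<in> cyc_ring N. cyc_mult N \<tau> (cyc_conj N \<tau>) = \<alpha>}"

text \<open>
  For an autocorrelation \<open>\<alpha>\<close> the Fourier components are real and non-negative, so \<open>Re\<close> below only
  adjusts the type.
\<close>

definition cyc_hT :: "nat \<Rightarrow> real poly \<Rightarrow> real poly set" where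
  "cyc_hT N \<alpha> = {\<tau> \<in> cyc_ring N.
     \<forall>i \<le> (N - 1) div 2. cmod (fourier N i \<tau>) \<le> sqrt (Re (fourier N i \<alpha>))}"

end

theory Submission
  imports Defs
begin

text \<open>
  An element of \<open>T_\<alpha>\<close> has the same Fourier magnitudes as the binary element defining \<open>\<alpha>\<close>, hence by
  Parseval's identity the same sum of squared components \<open>N/4\<close>. If moreover all components are at
  most \<open>1/2\<close> in absolute value, they must all be \<open>\<plusminus>1/2\<close>. Dually, a \<open>\<plusminus>1/2\<close>-vector
  has squared norm \<open>N/4\<close>, so bounds on its Fourier magnitudes by those prescribed by \<open>\<alpha>\<close> must all be
  equalities, and the Fourier transform is injective.
\<close>

section \<open>Roots of unity and orthogonality of characters\<close>

definition zeta :: "nat \<Rightarrow> complex" where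
  "zeta N = exp (2 * of_real pi * \<i> / of_nat N)"

lemma zeta_power_eq_iff:
  assumes "k < N" "l < N"
  shows "zeta N ^ k = zeta N ^ l \<longleftrightarrow> k = l"
proof -
  have pw: "zeta N ^ m = exp (2 * of_real pi * \<i> * of_nat m / of_nat N)" for m
    unfolding zeta_def by (simp flip: exp_of_nat_mult add: mult_ac)
  show ?thesis
    using complex_root_unity_eq[of N k l] assms by (simp add: pw cong_def)
qed

lemma zeta_power_N: "N > 0 \<Longrightarrow> zeta N ^ N = 1"
  unfolding zeta_def by (simp flip: exp_of_nat_mult)

lemma norm_zeta [simp]: "norm (zeta N) = 1"
proof -
  have "zeta N = exp (\<i> * of_real (2 * pi / real N))"
    by (simp add: zeta_def mult_ac)
  then show ?thesis
    by (simp only: norm_exp_i_times)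
qed

lemma zeta_mult_cnj [simp]: "zeta N * cnj (zeta N) = 1"
  by (simp add: complex_norm_square[symmetric])

lemma zeta_power_mult_cnj_power: "zeta N ^ k * cnj (zeta N) ^ k = 1"
  by (simp flip: power_mult_distrib)

text \<open>The summands form a geometric progression whose ratio is an \<open>N\<close>-th root of
  unity, and this ratio is 1 only for \<open>k = l\<close>.\<close>

lemma zeta_orthogonality:
  assumes "k < N" "l < N"
  shows "(\<Sum>j<N. zeta N ^ (j * k) * cnj (zeta N ^ (j * l))) = (if k = l then of_nat N else 0)"
proof -
  \<comment> \<open>This is the power of \<open>zeta N\<close> with exponent \<open>k - l\<close>;
    the conjugate serves as the inverse, so no natural subtraction occurs.\<close>
  define w where "w = zeta N ^ k * cnj (zeta N) ^ l"
  have w1: "w = 1 \<longleftrightarrow> k = l"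
  proof
    assume "w = 1"
    then have "zeta N ^ k * (zeta N ^ l * cnj (zeta N) ^ l) = zeta N ^ l"
      by (simp add: w_def mult_ac)
    then show "k = l"
      using zeta_power_eq_iff[OF assms] by (simp add: zeta_power_mult_cnj_power)
  qed (simp add: w_def zeta_power_mult_cnj_power)
  have "w ^ N = (zeta N ^ N) ^ k * cnj (zeta N ^ N) ^ l"
    by (simp add: w_def power_mult_distrib flip: power_mult) (simp add: mult.commute)
  then have wN: "w ^ N = 1"
    using assms by (simp add: zeta_power_N)
  have "(\<Sum>j<N. zeta N ^ (j * k) * cnj (zeta N ^ (j * l))) = (\<Sum>j<N. w ^ j)"
    by (simp add: w_def power_mult_distrib mult.commute flip: power_mult)
  also have "\<dots> = (if k = l then of_nat N else 0)"
    using w1 wN geometric_sum[of w N] by auto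
  finally show ?thesis .
qed

section \<open>Inversion, injectivity, Parseval and reflection for the Fourier transform\<close>

lemma fourier_zeta: "fourier N j \<alpha> = (\<Sum>k<N. of_real (coeff \<alpha> k) * zeta N ^ (j * k))"
  by (simp add: fourier_def zeta_def)

lemma fourier_inversion:
  assumes "l < N"
  shows "(\<Sum>j<N. fourier N j \<alpha> * cnj (zeta N ^ (j * l))) = of_nat N * of_real (coeff \<alpha> l)"
proof -
  have "(\<Sum>j<N. fourier N j \<alpha> * cnj (zeta N ^ (j * l)))
      = (\<Sum>k<N. \<Sum>j<N. of_real (coeff \<alpha> k) * (zeta N ^ (j * k) * cnj (zeta N ^ (j * l))))"
    unfolding fourier_zeta sum_distrib_right by (subst sum.swap) (simp only: mult.assoc)
  also have "\<dots> = (\<Sum>k<N. of_real (coeff \<alpha> k) * (if k = l then of_nat N else 0))"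
    using assms by (intro sum.cong refl) (simp only: lessThan_iff zeta_orthogonality flip: sum_distrib_left)
  also have "\<dots> = of_nat N * of_real (coeff \<alpha> l)"
    using assms by (simp add: if_distrib[of "(*) _"] sum.delta mult.commute cong: if_cong)
  finally show ?thesis .
qed

text \<open>Inversion recovers the coefficients below \<open>N\<close>; the degree bound in
  \<open>cyc_ring\<close> makes all others vanish.\<close>

lemma fourier_inject:
  assumes "\<alpha> \<in> cyc_ring N" "\<beta> \<in> cyc_ring N"
    and "\<And>j. j < N \<Longrightarrow> fourier N j \<alpha> = fourier N j \<beta>"
  shows "\<alpha> = \<beta>"
proof (rule poly_eqI)
  fix l
  show "coeff \<alpha> l = coeff \<beta> l"
  proof (cases "l < N")
    case True
    have "(of_nat N * of_real (coeff \<alpha> l) :: complex) = of_nat N * of_real (coeff \<beta> l)"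
      unfolding fourier_inversion[OF True, symmetric] using assms(3) by simp
    then show ?thesis
      using True by simp
  next
    case False
    then show ?thesis
      using assms(1,2) by (simp add: cyc_ring_def coeff_eq_0)
  qed
qed

lemma fourier_parseval:
  "(\<Sum>j<N. (cmod (fourier N j \<alpha>))\<^sup>2) = real N * (\<Sum>k<N. (coeff \<alpha> k)\<^sup>2)"
proof -
  have "complex_of_real (\<Sum>j<N. (cmod (fourier N j \<alpha>))\<^sup>2)
      = (\<Sum>j<N. fourier N j \<alpha> * cnj (fourier N j \<alpha>))"
    by (simp only: of_real_sum complex_norm_square)
  \<comment> \<open>Only the conjugated factor is expanded, so that after swapping the sums the
    inner one is evaluated by \<open>fourier_inversion\<close>.\<close>
  also have "\<dots> = (\<Sum>j<N. \<Sum>k<N. of_real (coeff \<alpha> k) * (fourier N j \<alpha> * cnj (zeta N ^ (j * k))))"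
    by (subst (2) fourier_zeta) (simp add: sum_distrib_left mult_ac)
  also have "\<dots> = (\<Sum>k<N. of_real (coeff \<alpha> k) * (\<Sum>j<N. fourier N j \<alpha> * cnj (zeta N ^ (j * k))))"
    by (subst sum.swap) (simp only: sum_distrib_left)
  also have "\<dots> = (\<Sum>k<N. of_real (coeff \<alpha> k) * (of_nat N * of_real (coeff \<alpha> k)))"
    by (intro sum.cong refl) (simp only: lessThan_iff fourier_inversion)
  also have "\<dots> = complex_of_real (real N * (\<Sum>k<N. (coeff \<alpha> k)\<^sup>2))"
    by (simp add: sum_distrib_left power2_eq_square mult_ac)
  finally show ?thesis
    by (simp only: of_real_eq_iff)
qed

text \<open>The coefficients are real and conjugation inverts \<open>zeta N\<close>. This carries
  bounds on the lower half of the spectrum over to the upper half.\<close>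

lemma fourier_reflect:
  assumes "j < N"
  shows "fourier N (N - j) \<alpha> = cnj (fourier N j \<alpha>)"
proof -
  have "zeta N ^ ((N - j) * k) = cnj (zeta N ^ (j * k))" for k
  proof -
    have "zeta N ^ ((N - j) * k) * zeta N ^ (j * k) = (zeta N ^ N) ^ k"
      using assms by (simp flip: power_add power_mult distrib_right)
    then have "zeta N ^ ((N - j) * k) * (zeta N ^ (j * k) * cnj (zeta N) ^ (j * k))
        = cnj (zeta N) ^ (j * k)"
      using assms by (simp add: zeta_power_N flip: mult.assoc)
    then show ?thesis
      by (simp add: zeta_power_mult_cnj_power)
  qed
  then show ?thesis
    by (simp add: fourier_zeta)
qed

section \<open>Conjugation and cyclic product under the Fourier transform\<close>

lemma coeff_cyc_conj:
  "j < N \<Longrightarrow> coeff (cyc_conj N \<alpha>) j = (if j = 0 then coeff \<alpha> 0 else coeff \<alpha> (N - j))"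
  by (simp add: cyc_conj_def coeff_sum sum.delta)

lemma cyc_conj_in_cyc_ring: "N > 0 \<Longrightarrow> cyc_conj N \<alpha> \<in> cyc_ring N"
  unfolding cyc_ring_def cyc_conj_def
  by (auto intro!: degree_sum_less le_less_trans[OF degree_monom_le])

lemma fourier_cyc_conj:
  assumes "N > 0"
  shows "fourier N j (cyc_conj N \<alpha>) = cnj (fourier N j \<alpha>)"
proof -
  \<comment> \<open>Index 0 is treated apart: \<open>k\<close> to \<open>N - k\<close> permutes
    \<open>{1..<N}\<close> but would send 0 to \<open>N\<close>.\<close>
  have split: "{..<N} = insert 0 {1..<N}"
    using assms by auto
  have refl: "zeta N ^ (j * (N - k)) = cnj (zeta N) ^ (j * k)" if "k < N" for k
  proof -
    have "zeta N ^ (j * (N - k)) * zeta N ^ (j * k) = (zeta N ^ N) ^ j"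
      using that by (simp add: mult.commute flip: power_add power_mult distrib_left)
    then have "zeta N ^ (j * (N - k)) * (zeta N ^ (j * k) * cnj (zeta N) ^ (j * k))
        = cnj (zeta N) ^ (j * k)"
      using assms by (simp add: zeta_power_N flip: mult.assoc)
    then show ?thesis
      by (simp add: zeta_power_mult_cnj_power)
  qed
  have "(\<Sum>k\<in>{1..<N}. of_real (coeff \<alpha> (N - k)) * zeta N ^ (j * k))
      = (\<Sum>k\<in>{1..<N}. of_real (coeff \<alpha> k) * zeta N ^ (j * (N - k)))"
    by (rule sum.reindex_bij_witness[of _ "\<lambda>k. N - k" "\<lambda>k. N - k"]) auto
  also have "\<dots> = (\<Sum>k\<in>{1..<N}. of_real (coeff \<alpha> k) * cnj (zeta N) ^ (j * k))"
    by (intro sum.cong) (auto simp: refl)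
  finally show ?thesis
    using assms by (simp add: fourier_zeta split coeff_cyc_conj)
qed

lemma cyc_mult_in_cyc_ring:
  assumes "N > 0"
  shows "cyc_mult N \<alpha> \<beta> \<in> cyc_ring N"
proof -
  have deg: "degree (monom 1 N - 1 :: real poly) = N"
    using assms unfolding diff_conv_add_uminus
    by (subst degree_add_eq_left) (simp_all add: degree_monom_eq)
  then have "monom 1 N - 1 \<noteq> (0 :: real poly)"
    using assms by auto
  then show ?thesis
    using degree_mod_less[of "monom 1 N - 1" "\<alpha> * \<beta>"] deg assms
    by (auto simp: cyc_ring_def cyc_mult_def)
qed

text \<open>Seeing the components as values of a polynomial makes the reduction modulo
  \<open>x^N - 1\<close> tractable. The degree bound ensures that the sum below \<open>N\<close>
  reaches every nonzero coefficient.\<close>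

lemma fourier_eq_poly:
  assumes "\<alpha> \<in> cyc_ring N"
  shows "fourier N j \<alpha> = poly (map_poly of_real \<alpha>) (zeta N ^ j)"
proof -
  have "poly (map_poly of_real \<alpha>) (zeta N ^ j)
      = (\<Sum>k\<le>degree \<alpha>. of_real (coeff \<alpha> k) * zeta N ^ (j * k))"
    by (simp add: poly_altdef coeff_map_poly degree_map_poly power_mult)
  also have "\<dots> = fourier N j \<alpha>"
    unfolding fourier_zeta
    using assms by (intro sum.mono_neutral_left) (auto simp: cyc_ring_def coeff_eq_0)
  finally show ?thesis ..
qed

text \<open>Evaluation is multiplicative, and at an \<open>N\<close>-th root of unity it kills every
  multiple of \<open>x^N - 1\<close>, so reducing the product does not change the value.\<close>

lemma fourier_cyc_mult:
  assumes "N > 0" "\<alpha> \<in> cyc_ring N" "\<beta> \<in> cyc_ring N"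
  shows "fourier N j (cyc_mult N \<alpha> \<beta>) = fourier N j \<alpha> * fourier N j \<beta>"
proof -
  define q where "q = (\<alpha> * \<beta>) div (monom 1 N - 1)"
  define z where "z = zeta N ^ j"
  have hom_mult: "map_poly complex_of_real (p * r) = map_poly of_real p * map_poly of_real r" for p r
    by (rule poly_eqI) (simp add: coeff_map_poly coeff_mult)
  have hom_add: "map_poly complex_of_real (p + r) = map_poly of_real p + map_poly of_real r" for p r
    by (rule poly_eqI) (simp add: coeff_map_poly)
  have "map_poly complex_of_real (monom 1 N - 1) = monom 1 N - 1"
    by (rule poly_eqI) (simp add: coeff_map_poly)
  moreover have "z ^ N = (zeta N ^ N) ^ j"
    by (simp only: z_def mult.commute flip: power_mult)
  ultimately have zero: "poly (map_poly complex_of_real (monom 1 N - 1)) z = 0"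
    using assms(1) by (simp add: poly_monom zeta_power_N)
  have "\<alpha> * \<beta> = q * (monom 1 N - 1) + cyc_mult N \<alpha> \<beta>"
    by (simp only: q_def cyc_mult_def div_mult_mod_eq)
  then have "map_poly complex_of_real (\<alpha> * \<beta>)
      = map_poly of_real q * map_poly of_real (monom 1 N - 1) + map_poly of_real (cyc_mult N \<alpha> \<beta>)"
    by (simp only: hom_mult hom_add)
  then have "poly (map_poly of_real (\<alpha> * \<beta>)) z = poly (map_poly of_real (cyc_mult N \<alpha> \<beta>)) z"
    using zero by simp
  then show ?thesis
    using assms by (simp add: fourier_eq_poly cyc_mult_in_cyc_ring hom_mult z_def)
qed

lemma fourier_autocorrelation:
  assumes "N > 0" "\<tau> \<in> cyc_ring N"
  shows "fourier N j (cyc_mult N \<tau> (cyc_conj N \<tau>)) = of_real ((cmod (fourier N j \<tau>))\<^sup>2)"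
  unfolding complex_norm_square
  using assms by (simp add: fourier_cyc_mult cyc_conj_in_cyc_ring fourier_cyc_conj)

text \<open>Both sides of the equation defining \<open>cyc_T\<close> lie in
  \<open>cyc_ring N\<close>, so by injectivity they may be compared component by component.\<close>

lemma cyc_T_iff:
  assumes "N > 0" "\<alpha> \<in> cyc_ring N"
  shows "\<tau> \<in> cyc_T N \<alpha> \<longleftrightarrow>
    \<tau> \<in> cyc_ring N \<and> (\<forall>j<N. fourier N j \<alpha> = of_real ((cmod (fourier N j \<tau>))\<^sup>2))"
proof (cases "\<tau> \<in> cyc_ring N")
  case True
  then have "cyc_mult N \<tau> (cyc_conj N \<tau>) = \<alpha> \<longleftrightarrow>
      (\<forall>j<N. fourier N j \<alpha> = of_real ((cmod (fourier N j \<tau>))\<^sup>2))"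
    using fourier_inject[OF assms(2) cyc_mult_in_cyc_ring[OF assms(1)]] fourier_autocorrelation[OF assms(1)]
    by metis
  with True show ?thesis
    by (simp add: cyc_T_def)
qed (simp add: cyc_T_def)

section \<open>Square sums and bounds on Fourier magnitudes\<close>

lemma square_sum_cyc_B:
  assumes "\<beta> \<in> cyc_B N"
  shows "(\<Sum>k<N. (coeff \<beta> k)\<^sup>2) = real N / 4"
proof -
  have "(coeff \<beta> k)\<^sup>2 = 1 / 4" if "k < N" for k
  proof -
    have "coeff \<beta> k = 1/2 \<or> coeff \<beta> k = - 1/2"
      using assms that by (simp add: cyc_B_def)
    then show ?thesis
      by (elim disjE ssubst) (simp_all add: power2_eq_square)
  qed
  then have "(\<Sum>k<N. (coeff \<beta> k)\<^sup>2) = (\<Sum>k<N. 1 / 4)"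
    by (intro sum.cong) simp_all
  then show ?thesis
    by simp
qed

lemma cyc_hB_square_sum_imp_cyc_B:
  assumes "\<tau> \<in> cyc_hB N" "(\<Sum>k<N. (coeff \<tau> k)\<^sup>2) = real N / 4"
  shows "\<tau> \<in> cyc_B N"
proof -
  have le: "(coeff \<tau> k)\<^sup>2 \<le> 1 / 4" if "k < N" for k
    using assms(1) that abs_le_square_iff[of "coeff \<tau> k" "1/2"]
    by (auto simp: cyc_hB_def power2_eq_square)
  have "coeff \<tau> k = 1/2 \<or> coeff \<tau> k = - 1/2" if "k < N" for k
  proof -
    \<comment> \<open>The \<open>N\<close> squares are each at most 1/4 and add up to
      \<open>N/4\<close>, so none can be smaller.\<close>
    have "(coeff \<tau> k)\<^sup>2 = 1 / 4"
      using sum_mono_inv[of "\<lambda>k. (coeff \<tau> k)\<^sup>2" "{..<N}" "\<lambda>_. 1 / 4" k] assms(2) le that by simp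
    then have "(coeff \<tau> k)\<^sup>2 = (1 / 2)\<^sup>2"
      by (simp add: power2_eq_square)
    then show ?thesis
      by (simp add: power2_eq_iff)
  qed
  with assms(1) show ?thesis
    by (auto simp: cyc_B_def cyc_hB_def)
qed

lemma cyc_hT_cmod_le:
  assumes "odd N" "\<alpha> = cyc_mult N \<beta> (cyc_conj N \<beta>)" "\<beta> \<in> cyc_ring N"
    and "\<tau> \<in> cyc_hT N \<alpha>" "j < N"
  shows "cmod (fourier N j \<tau>) \<le> cmod (fourier N j \<beta>)"
proof -
  have N: "N > 0"
    using assms(5) by simp
  have low: "cmod (fourier N i \<tau>) \<le> cmod (fourier N i \<beta>)" if "i \<le> (N - 1) div 2" for i
    using assms(4) that fourier_autocorrelation[OF N assms(3), of i]
    by (auto simp: cyc_hT_def assms(2))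
  show ?thesis
  proof (cases "j \<le> (N - 1) div 2")
    case False
    \<comment> \<open>Oddness matters here: for even \<open>N\<close> the index \<open>N/2\<close>
      would be its own reflection and lie above \<open>(N - 1) div 2\<close>.\<close>
    then have "N - j \<le> (N - 1) div 2"
      using assms(1) by (elim oddE) auto
    from low[OF this] show ?thesis
      using assms(5) by (simp add: fourier_reflect)
  qed (rule low)
qed

theorem theorem1:
  fixes N :: nat and \<alpha> :: "real poly"
  assumes "prime N" and "odd N"
    and "\<alpha> \<in> cyc_ring N"
    and "\<exists>\<beta>. cyc_binary N \<beta> \<and> \<alpha> = cyc_mult N \<beta> (cyc_conj N \<beta>)"
  shows "cyc_B N \<inter> cyc_T N \<alpha> = cyc_hB N \<inter> cyc_T N \<alpha> \<and>
         cyc_hB N \<inter> cyc_T N \<alpha> = cyc_B N \<inter> cyc_hT N \<alpha>"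
proof -
  obtain \<beta> where \<beta>: "\<beta> \<in> cyc_B N" and \<alpha>: "\<alpha> = cyc_mult N \<beta> (cyc_conj N \<beta>)"
    using assms(4) by (auto simp: cyc_binary_def)
  have \<beta>R: "\<beta> \<in> cyc_ring N"
    using \<beta> by (simp add: cyc_B_def)
  have N: "N > 0"
    using assms(2) by (rule odd_pos)
  have F: "fourier N j \<alpha> = of_real ((cmod (fourier N j \<beta>))\<^sup>2)" for j
    unfolding \<alpha> by (rule fourier_autocorrelation[OF N \<beta>R])
  \<comment> \<open>Through \<open>F\<close>, the set depends on \<open>\<beta>\<close> only via its
    Fourier magnitudes.\<close>
  have T_iff: "\<tau> \<in> cyc_T N \<alpha> \<longleftrightarrow>
      \<tau> \<in> cyc_ring N \<and> (\<forall>j<N. (cmod (fourier N j \<tau>))\<^sup>2 = (cmod (fourier N j \<beta>))\<^sup>2)" for \<tau>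
    unfolding cyc_T_iff[OF N assms(3)] F of_real_eq_iff by metis
  have sub: "cyc_B N \<subseteq> cyc_hB N"
    by (auto simp: cyc_B_def cyc_hB_def)
  have hB: "\<tau> \<in> cyc_B N" if "\<tau> \<in> cyc_hB N" "\<tau> \<in> cyc_T N \<alpha>" for \<tau>
  proof -
    have "(\<Sum>j<N. (cmod (fourier N j \<tau>))\<^sup>2) = (\<Sum>j<N. (cmod (fourier N j \<beta>))\<^sup>2)"
      using that(2) by (auto simp: T_iff)
    then have "(\<Sum>k<N. (coeff \<tau> k)\<^sup>2) = real N / 4"
      using N by (simp add: fourier_parseval square_sum_cyc_B[OF \<beta>])
    then show ?thesis
      by (rule cyc_hB_square_sum_imp_cyc_B[OF that(1)])
  qed
  have hT: "\<tau> \<in> cyc_T N \<alpha>" if "\<tau> \<in> cyc_B N" "\<tau> \<in> cyc_hT N \<alpha>" for \<tau>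
  proof -
    have le: "(cmod (fourier N j \<tau>))\<^sup>2 \<le> (cmod (fourier N j \<beta>))\<^sup>2" if "j < N" for j
      using cyc_hT_cmod_le[OF assms(2) \<alpha> \<beta>R \<open>\<tau> \<in> cyc_hT N \<alpha>\<close> that] by (simp add: power_mono)
    \<comment> \<open>Both sides are \<open>N\<close> times \<open>N/4\<close>, since
      \<open>\<tau>\<close> and \<open>\<beta>\<close> both lie in \<open>cyc_B N\<close>.\<close>
    have "(\<Sum>j<N. (cmod (fourier N j \<tau>))\<^sup>2) = (\<Sum>j<N. (cmod (fourier N j \<beta>))\<^sup>2)"
      by (simp add: fourier_parseval square_sum_cyc_B \<beta> that(1))
    then have "(cmod (fourier N j \<tau>))\<^sup>2 = (cmod (fourier N j \<beta>))\<^sup>2" if "j < N" for j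
      using sum_mono_inv[of "\<lambda>j. (cmod (fourier N j \<tau>))\<^sup>2" "{..<N}"
          "\<lambda>j. (cmod (fourier N j \<beta>))\<^sup>2" j] that le by simp
    then show ?thesis
      using that(1) by (simp add: T_iff cyc_B_def)
  qed
  have T: "\<tau> \<in> cyc_hT N \<alpha>" if "\<tau> \<in> cyc_T N \<alpha>" for \<tau>
  proof -
    have "i < N" if "i \<le> (N - 1) div 2" for i
      using that N by linarith
    then have "cmod (fourier N i \<tau>) = cmod (fourier N i \<beta>)" if "i \<le> (N - 1) div 2" for i
      using that \<open>\<tau> \<in> cyc_T N \<alpha>\<close> by (simp add: T_iff)
    moreover have "\<tau> \<in> cyc_ring N"
      using that by (simp add: T_iff)
    ultimately show ?thesis
      by (simp add: cyc_hT_def F)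
  qed
  show ?thesis
    \<comment> \<open>The first equality is \<open>sub\<close> with \<open>hB\<close>. For the
      second, \<open>hB\<close> and \<open>T\<close> give the inclusion from left to right,
      \<open>sub\<close> and \<open>hT\<close> the converse.\<close>
    using sub hB hT T by blast
qed

end
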